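(* Let $d\ge 1$, let $\Sigma$ be a real symmetric positive-definite $d\times d$ matrix and let $\mu_1,\mu_2\in\mathbb{R}^d$. Write $\Delta=\Delta_\Sigma(\mu_1,\mu_2)=\sqrt{(\mu_2-\mu_1)^\top\Sigma^{-1}(\mu_2-\mu_1)}$ for the Mahalanobis distance. Then the Fisher-Rao distance between the $d$-variate normal distributions $N(\mu_1,\Sigma)$ and $N(\mu_2,\Sigma)$ (which share the same covariance matrix), computed in the manifold of all $d$-variate normal distributions, satisfies $$\rho_{\mathcal{N}}\big((\mu_1,\Sigma),(\mu_2,\Sigma)\big)=\sqrt{2}\,\log\left(\frac{\sqrt{8+\Delta^2}+\Delta}{\sqrt{8+\Delta^2}-\Delta}\right)=\rho_{\mathcal{N}}\big((0,1),(\Delta,1)\big)=\sqrt{2}\,\operatorname{arccosh}\left(1+\frac14\Delta^2\right),$$ where $\rho_{\mathcal{N}}((0,1),(\Delta,1))$ is the Fisher-Rao distance between the univariate normal distributions $N(0,1)$ and $N(\Delta,1)$.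
   Context: Let $\mathbb{P}(d)$ be the set of real symmetric positive-definite $d\times d$ matrices. The $d$-variate normal distributions $N(\mu,\Sigma)$ are identified with their parameters $(\mu,\Sigma)\in\mathbb{R}^d\times\mathbb{P}(d)$, where $\mu$ is the mean and $\Sigma$ the covariance matrix (for $d=1$, $(\mu,\sigma^2)$ with $\sigma^2$ the variance). The Fisher information metric on this manifold has squared line element $$ds^2_{\mathcal{N}}(\mu,\Sigma)=d\mu^\top\Sigma^{-1}d\mu+\tfrac12\operatorname{tr}\big((\Sigma^{-1}d\Sigma)^2\big),$$ i.e. a tangent vector $(v,V)$ at $(\mu,\Sigma)$ (with $v\in\mathbb{R}^d$ and $V$ symmetric) has squared norm $v^\top\Sigma^{-1}v+\frac12\operatorname{tr}((\Sigma^{-1}V)^2)$. The Fisher-Rao distance $\rho_{\mathcal{N}}(N_1,N_2)$ is the associated Riemannian distance: the infimum of the lengths of smooth curves in $\mathbb{R}^d\times\mathbb{P}(d)$ joining the parameters of $N_1$ to those of $N_2$. For $x\ge 1$, $\operatorname{arccosh}(x)=\log(x+\sqrt{x^2-1})$. *)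

theory Defs
  imports "HOL-Analysis.Analysis"
begin

definition pos_def_mat :: "real^'d^'d \<Rightarrow> bool" where
  "pos_def_mat S \<longleftrightarrow> transpose S = S \<and> (\<forall>x. x \<noteq> 0 \<longrightarrow> 0 < x \<bullet> (S *v x))"

definition normal_params :: "((real^'d) \<times> (real^'d^'d)) set" where
  "normal_params = UNIV \<times> {S. pos_def_mat S}"

definition mahalanobis :: "real^'d^'d \<Rightarrow> real^'d \<Rightarrow> real^'d \<Rightarrow> real" where
  "mahalanobis S \<mu> \<nu> = sqrt ((\<nu> - \<mu>) \<bullet> (matrix_inv S *v (\<nu> - \<mu>)))"

fun fisher_norm2 :: "(real^'d) \<times> (real^'d^'d) \<Rightarrow> (real^'d) \<times> (real^'d^'d) \<Rightarrow> real" where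
  "fisher_norm2 (\<mu>, S) (v, V) =
     v \<bullet> (matrix_inv S *v v) +
     1 / 2 * trace ((matrix_inv S ** V) ** (matrix_inv S ** V))"

text \<open>Infinitely differentiable on the closed unit interval, with one-sided derivatives at the
  end points; \<open>D k\<close> is the \<open>k\<close>-th derivative.\<close>

definition smooth_path :: "(real \<Rightarrow> 'a::real_normed_vector) \<Rightarrow> bool" where
  "smooth_path \<gamma> \<longleftrightarrow>
     (\<exists>D :: nat \<Rightarrow> real \<Rightarrow> 'a. (\<forall>t\<in>{0..1}. D 0 t = \<gamma> t) \<and>
       (\<forall>k. \<forall>t\<in>{0..1}. (D k has_vector_derivative D (Suc k) t) (at t within {0..1})))"

text \<open>The derivative of a curve in \<open>normal_params\<close> automatically has a symmetric matrix component.\<close>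

definition fisher_length :: "(real \<Rightarrow> (real^'d) \<times> (real^'d^'d)) \<Rightarrow> real" where
  "fisher_length \<gamma> =
     integral {0..1} (\<lambda>t. sqrt (fisher_norm2 (\<gamma> t) (vector_derivative \<gamma> (at t within {0..1}))))"

definition normal_curves ::
  "(real^'d) \<times> (real^'d^'d) \<Rightarrow> (real^'d) \<times> (real^'d^'d) \<Rightarrow> (real \<Rightarrow> (real^'d) \<times> (real^'d^'d)) set" where
  "normal_curves p q =
     {\<gamma>. smooth_path \<gamma> \<and> path_image \<gamma> \<subseteq> normal_params \<and> pathstart \<gamma> = p \<and> pathfinish \<gamma> = q}"

text \<open>For \<open>p\<close> and \<open>q\<close> in \<open>normal_params\<close> the lengths are nonnegative and there is at least one curve
  (\<open>normal_curves_nonempty\<close>), so \<open>Inf\<close> on the reals is the intended infimum.\<close>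

definition fisher_rao :: "(real^'d) \<times> (real^'d^'d) \<Rightarrow> (real^'d) \<times> (real^'d^'d) \<Rightarrow> real" where
  "fisher_rao p q = (INF \<gamma>\<in>normal_curves p q. fisher_length \<gamma>)"

lemma pos_def_mat_convex:
  assumes "pos_def_mat S" "pos_def_mat T" "0 \<le> t" "t \<le> 1"
  shows "pos_def_mat (S + t *\<^sub>R (T - S))"
proof -
  have e: "S + t *\<^sub>R (T - S) = (1 - t) *\<^sub>R S + t *\<^sub>R T"
    by (simp add: algebra_simps)
  have tr: "transpose ((1 - t) *\<^sub>R S + t *\<^sub>R T) = (1 - t) *\<^sub>R S + t *\<^sub>R T"
    using assms unfolding pos_def_mat_def
    by (simp add: transpose_def vec_eq_iff)
  have "0 < x \<bullet> (((1 - t) *\<^sub>R S + t *\<^sub>R T) *v x)" if "x \<noteq> 0" for x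
  proof -
    have "x \<bullet> (((1 - t) *\<^sub>R S + t *\<^sub>R T) *v x) = (1 - t) * (x \<bullet> (S *v x)) + t * (x \<bullet> (T *v x))"
      by (simp add: matrix_vector_mult_add_rdistrib inner_add_right scaleR_matrix_vector_assoc[symmetric])
    moreover have "0 < x \<bullet> (S *v x)" "0 < x \<bullet> (T *v x)"
      using assms that by (auto simp: pos_def_mat_def)
    ultimately show ?thesis
      using assms(3,4) by (cases "t = 0") (simp_all add: add_nonneg_pos)
  qed
  with tr e show ?thesis by (simp add: pos_def_mat_def)
qed

lemma normal_curves_nonempty:
  assumes "p \<in> normal_params" "q \<in> normal_params"
  shows "normal_curves p q \<noteq> {}"
proof -
  define \<gamma> where "\<gamma> = (\<lambda>t::real. p + t *\<^sub>R (q - p))"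
  define D where "D = (\<lambda>k. if k = 0 then \<gamma> else (\<lambda>_. if k = (1::nat) then q - p else 0))"
  have "(D k has_vector_derivative D (Suc k) t) (at t within {0..1})" for k t
    by (auto simp: D_def \<gamma>_def intro!: derivative_eq_intros)
  then have "smooth_path \<gamma>"
    unfolding smooth_path_def by (intro exI[of _ D]) (simp add: D_def)
  moreover have "\<gamma> t \<in> normal_params" if "t \<in> {0..1}" for t
  proof -
    have "pos_def_mat (snd (\<gamma> t))"
      using assms that pos_def_mat_convex[of "snd p" "snd q" t]
      by (simp add: \<gamma>_def normal_params_def mem_Times_iff)
    then show ?thesis by (simp add: normal_params_def mem_Times_iff)
  qed
  ultimately have "\<gamma> \<in> normal_curves p q"
    by (simp add: normal_curves_def path_image_def image_subset_iff)
      (simp add: \<gamma>_def pathstart_def pathfinish_def)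
  then show ?thesis by blast
qed

end

theory Submission
  imports Defs "HOL-Computational_Algebra.Polynomial"
begin

text \<open>Choose \<open>a\<close> with \<open>a \<bullet> \<Sigma> a = 1\<close> and \<open>\<mu>\<^sub>2 - \<mu>\<^sub>1 = \<Delta> \<Sigma> a\<close>. Passing to the marginal distribution
  \<open>(m, s) = (a \<bullet> \<mu>, a \<bullet> S a)\<close> does not increase the Fisher norm, and in the half-plane of univariate
  normals \<open>\<surd>2 arsinh ((m - m\<^sub>0) / \<surd>(2 s))\<close>, the signed distance to the vertical geodesic \<open>m = m\<^sub>0\<close>, is
  1-Lipschitz. With \<open>m\<^sub>0\<close> halfway between the two means it bounds every length from below by
  \<open>2 \<surd>2 arsinh (\<Delta> / (2 \<surd>2))\<close>. The bound is attained by the univariate geodesic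
  \<open>(m, s)\<close>, lifted to the curve \<open>(\<mu>\<^sub>1 + m \<Sigma> a, \<Sigma> + (s - 1) (\<Sigma> a) (\<Sigma> a)\<^sup>T)\<close>.\<close>

section \<open>Rank-one matrices and matrix algebra\<close>

definition outer :: "real^'n \<Rightarrow> real^'n^'n" where
  "outer w = (\<chi> i j. w $ i * w $ j)"

lemma outer_mult_vec: "outer w *v x = (w \<bullet> x) *\<^sub>R w"
  by (simp add: outer_def matrix_vector_mult_def vec_eq_iff inner_vec_def
      sum_distrib_left mult_ac)

lemma transpose_outer: "transpose (outer w) = outer w"
  by (simp add: outer_def transpose_def vec_eq_iff)

lemma trace_mult_outer: "trace (A ** outer w) = w \<bullet> (A *v w)"
  by (simp add: trace_def outer_def matrix_matrix_mult_def matrix_vector_mult_def inner_vec_def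
      sum_distrib_left mult_ac)

lemma trace_scaleR: "trace (c *\<^sub>R A) = c * trace A" for A :: "real^'n^'n"
  by (simp add: trace_def sum_distrib_left)

lemma matrix_mult_scaleR_left: "(c *\<^sub>R A) ** B = c *\<^sub>R (A ** B)" for A B :: "real^'n^'n"
  by (simp add: matrix_matrix_mult_def vec_eq_iff sum_distrib_left mult_ac)

lemma matrix_mult_scaleR_right: "A ** (c *\<^sub>R B) = c *\<^sub>R (A ** B)" for A B :: "real^'n^'n"
  by (simp add: matrix_matrix_mult_def vec_eq_iff sum_distrib_left mult_ac)

lemma matrix_diff_ldistrib: "A ** (B - C) = A ** B - A ** C" for A B C :: "real^'n^'n"
  by (simp add: matrix_matrix_mult_def vec_eq_iff right_diff_distrib sum_subtractf)

lemma matrix_diff_rdistrib: "(B - C) ** A = B ** A - C ** A" for A B C :: "real^'n^'n"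
  by (simp add: matrix_matrix_mult_def vec_eq_iff left_diff_distrib sum_subtractf)

lemma symmetric_inner:
  "transpose S = S \<Longrightarrow> x \<bullet> (S *v y) = (S *v x) \<bullet> y" for S :: "real^'n^'n"
  by (simp add: dot_lmul_matrix[symmetric] transpose_matrix_vector[of S x, symmetric]
      del: transpose_matrix_vector)

lemma matrix_entry_inner: "axis i 1 \<bullet> (P *v axis j 1) = P $ i $ j" for P :: "real^'n^'m"
  by (simp add: inner_axis' matrix_vector_mult_basis column_def)

section \<open>Positive semidefinite matrices and a trace inequality\<close>

definition psd_mat :: "real^'n^'n \<Rightarrow> bool" where
  "psd_mat P \<longleftrightarrow> transpose P = P \<and> (\<forall>x. 0 \<le> x \<bullet> (P *v x))"

text \<open>The form is nonnegative on every combination of \<open>x\<close> and \<open>y\<close>.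
  As \<open>P\<close> may be singular, the case where it vanishes at \<open>y\<close> is treated
  separately.\<close>

lemma psd_mat_cauchy_schwarz:
  assumes "psd_mat P"
  shows "(x \<bullet> (P *v y))\<^sup>2 \<le> (x \<bullet> (P *v x)) * (y \<bullet> (P *v y))"
proof -
  let ?a = "x \<bullet> (P *v x)" and ?b = "x \<bullet> (P *v y)" and ?c = "y \<bullet> (P *v y)"
  have yx: "y \<bullet> (P *v x) = ?b"
    using assms by (metis inner_commute psd_mat_def symmetric_inner)
  have q: "0 \<le> s\<^sup>2 * ?a + 2 * s * t * ?b + t\<^sup>2 * ?c" for s t
  proof -
    have "0 \<le> (s *\<^sub>R x + t *\<^sub>R y) \<bullet> (P *v (s *\<^sub>R x + t *\<^sub>R y))"
      using assms by (simp add: psd_mat_def)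
    also have "\<dots> = s\<^sup>2 * ?a + 2 * s * t * ?b + t\<^sup>2 * ?c"
      by (simp add: matrix_vector_right_distrib matrix_vector_mult_scaleR inner_add yx
          power2_eq_square algebra_simps)
    finally show ?thesis .
  qed
  have a: "0 \<le> ?a" and c: "0 \<le> ?c" using assms by (auto simp: psd_mat_def)
  show ?thesis
  proof (cases "?c = 0")
    case True
    have "0 \<le> ?a - 2 * r * ?b" for r using q[of 1 "- r"] True by simp
    \<comment> \<open>If \<open>?b\<close> were nonzero, this \<open>r\<close> would turn the
      right-hand side into \<open>-1\<close>.\<close>
    from this[of "(?a + 1) / (2 * ?b)"] have "?b = 0" by (cases "?b = 0") auto
    then show ?thesis using True by simp
  next
    case False
    \<comment> \<open>The form evaluated at \<open>c x - b y\<close>, a multiple of the part of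
      \<open>x\<close> orthogonal to \<open>y\<close>.\<close>
    have "0 \<le> ?c * (?a * ?c - ?b\<^sup>2)"
      using q[of ?c "- ?b"] by (simp add: power2_eq_square algebra_simps)
    then show ?thesis using False c by (simp add: zero_le_mult_iff)
  qed
qed

text \<open>Induction on the number of nonzero pivots: a positive pivot splits off a rank-one summand,
  as in the Cholesky decomposition.\<close>

lemma trace_psd_mult_nonneg:
  fixes P Q :: "real^'n^'n"
  assumes "psd_mat P" and Q: "\<And>x. 0 \<le> x \<bullet> (Q *v x)"
  shows "0 \<le> trace (Q ** P)"
  using assms(1)
proof (induction "card {i. P $ i $ i \<noteq> 0}" arbitrary: P rule: less_induct)
  case less
  note psd = \<open>psd_mat P\<close>
  have entry: "(P $ i $ j)\<^sup>2 \<le> P $ i $ i * P $ j $ j" for i j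
    using psd_mat_cauchy_schwarz[OF psd, of "axis i 1" "axis j 1"] by (simp add: matrix_entry_inner)
  show ?case
  proof (cases "\<exists>i. P $ i $ i \<noteq> 0")
    case False
    then have "P $ i $ j = 0" for i j using entry[of i j] by simp
    then have "P = 0" by (simp add: vec_eq_iff)
    then show ?thesis by (simp add: trace_def matrix_matrix_mult_def)
  next
    case True
    then obtain i where i: "P $ i $ i \<noteq> 0" by auto
    have "0 \<le> axis i 1 \<bullet> (P *v axis i 1)" using psd unfolding psd_mat_def by blast
    with i have pos: "P $ i $ i > 0" by (simp add: matrix_entry_inner)
    \<comment> \<open>\<open>w\<close> is the \<open>i\<close>-th column of \<open>P\<close>, and
      passing to \<open>P'\<close> is the elimination step that clears row and column
      \<open>i\<close>.\<close>
    define w where "w = P *v axis i 1"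
    define P' where "P' = P - (1 / P $ i $ i) *\<^sub>R outer w"
    have wx: "w \<bullet> x = axis i 1 \<bullet> (P *v x)" for x
      using psd by (simp add: w_def psd_mat_def symmetric_inner)
    have quad: "x \<bullet> (P' *v x) = x \<bullet> (P *v x) - (w \<bullet> x)\<^sup>2 / P $ i $ i" for x
      by (simp add: P'_def matrix_vector_mult_diff_rdistrib inner_diff_right outer_mult_vec
          scaleR_matrix_vector_assoc[symmetric] power2_eq_square inner_commute)
    have "0 \<le> x \<bullet> (P' *v x)" for x
      using psd_mat_cauchy_schwarz[OF psd, of "axis i 1" x] pos
      by (simp add: quad wx matrix_entry_inner field_simps)
    moreover have "transpose P' = P'"
      using psd transpose_outer[of w]
      by (simp add: P'_def psd_mat_def transpose_def vec_eq_iff)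
    ultimately have psd': "psd_mat P'" by (simp add: psd_mat_def)
    have diag: "P' $ j $ j = P $ j $ j - (P $ i $ j)\<^sup>2 / P $ i $ i" for j
      using quad[of "axis j 1"] by (simp add: matrix_entry_inner wx)
    \<comment> \<open>A zero diagonal entry stays zero because \<open>entry\<close> makes
      \<open>P $ i $ j\<close> vanish; pivot \<open>i\<close> becomes zero, so the count drops
      strictly.\<close>
    have "P' $ j $ j = 0" if "P $ j $ j = 0" for j
      using entry[of i j] that by (simp add: diag)
    moreover have "P' $ i $ i = 0" using i by (simp add: diag power2_eq_square)
    ultimately have "{j. P' $ j $ j \<noteq> 0} \<subset> {j. P $ j $ j \<noteq> 0}" using i by auto
    then have "0 \<le> trace (Q ** P')" by (intro less psd' psubset_card_mono) auto
    moreover have "trace (Q ** P') = trace (Q ** P) - (w \<bullet> (Q *v w)) / P $ i $ i"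
      by (simp add: P'_def matrix_diff_ldistrib trace_sub matrix_mult_scaleR_right trace_scaleR
          trace_mult_outer)
    moreover have "0 \<le> (w \<bullet> (Q *v w)) / P $ i $ i" using Q pos by simp
    ultimately show ?thesis by linarith
  qed
qed

section \<open>Inverse covariance matrices and the Fisher norm of a marginal\<close>

lemma pos_def_imp_psd: "pos_def_mat S \<Longrightarrow> psd_mat S"
  unfolding pos_def_mat_def psd_mat_def
  by (metis inner_zero_left order_less_imp_le order_refl)

lemma pos_def_mat_invertible:
  assumes "pos_def_mat S"
  shows "invertible S"
proof -
  have "inj ((*v) S)"
  proof (rule injI)
    fix x y assume "S *v x = S *v y"
    then have "(x - y) \<bullet> (S *v (x - y)) = 0" by (simp add: matrix_vector_mult_diff_distrib)
    then have "x - y = 0" using assms by (metis less_irrefl pos_def_mat_def)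
    then show "x = y" by simp
  qed
  then show ?thesis by (simp add: invertible_left_inverse matrix_left_invertible_injective)
qed

lemma
  assumes "invertible (S :: real^'n^'n)"
  shows matrix_inv_right: "S ** matrix_inv S = mat 1"
    and matrix_inv_left: "matrix_inv S ** S = mat 1"
  using assms unfolding invertible_def matrix_inv_def by (metis (mono_tags, lifting) someI)+

lemma matrix_inv_unique:
  fixes A B :: "real^'n^'n"
  assumes "A ** B = mat 1"
  shows "matrix_inv A = B"
proof -
  have "invertible A" using assms by (metis invertible_right_inverse)
  then show ?thesis
    by (metis assms matrix_inv_left matrix_mul_assoc matrix_mul_lid matrix_mul_rid)
qed

text \<open>Substituting \<open>x = S y\<close> turns the form of the inverse at \<open>x\<close>
  into that of \<open>S\<close> at \<open>y\<close>. Symmetry holds because the transposed inverse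
  is also a right inverse of \<open>S\<close>.\<close>

lemma psd_mat_matrix_inv:
  assumes "pos_def_mat S"
  shows "psd_mat (matrix_inv S)"
proof -
  note inv = matrix_inv_right[OF pos_def_mat_invertible[OF assms]]
  have sym: "transpose S = S" using assms by (simp add: pos_def_mat_def)
  have "S ** transpose (matrix_inv S) = mat 1"
    using matrix_inv_left[OF pos_def_mat_invertible[OF assms]] sym
    by (metis matrix_transpose_mul transpose_mat)
  then have "transpose (matrix_inv S) = matrix_inv S" using matrix_inv_unique by metis
  moreover have "0 \<le> x \<bullet> (matrix_inv S *v x)" for x
  proof -
    have "x = S *v (matrix_inv S *v x)" by (simp add: matrix_vector_mul_assoc inv)
    then have "x \<bullet> (matrix_inv S *v x) = (matrix_inv S *v x) \<bullet> (S *v (matrix_inv S *v x))"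
      by (metis inner_commute)
    then show ?thesis using pos_def_imp_psd[OF assms] by (simp add: psd_mat_def)
  qed
  ultimately show ?thesis by (simp add: psd_mat_def)
qed

text \<open>\<open>P ** X\<close> need not be symmetric, but by cyclicity the trace is that of
  \<open>X P X\<close> times \<open>P\<close>, two positive semidefinite factors.\<close>

lemma trace_square_nonneg:
  assumes "psd_mat P" "transpose X = X"
  shows "0 \<le> trace ((P ** X) ** (P ** X))"
proof -
  have "0 \<le> x \<bullet> ((X ** P ** X) *v x)" for x
  proof -
    have "x \<bullet> ((X ** P ** X) *v x) = (X *v x) \<bullet> (P *v (X *v x))"
      using assms(2) by (simp add: matrix_vector_mul_assoc[symmetric] symmetric_inner)
    then show ?thesis using assms(1) by (simp add: psd_mat_def)
  qed
  then have "0 \<le> trace ((X ** P ** X) ** P)" by (intro trace_psd_mult_nonneg assms)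
  also have "trace ((X ** P ** X) ** P) = trace ((P ** X) ** (P ** X))"
    by (subst trace_mul_sym) (simp add: matrix_mul_assoc)
  finally show ?thesis .
qed

text \<open>Marginalisation contracts the Fisher metric: Cauchy--Schwarz for \<open>v\<close> against \<open>S u\<close> in the form
  \<open>S\<^sup>-\<^sup>1\<close>, and for \<open>V\<close> against \<open>(S u) (S u)\<^sup>T\<close> in the trace form.\<close>

lemma fisher_norm2_marginal:
  assumes S: "pos_def_mat S" and V: "transpose V = V" and u: "u \<noteq> 0"
  shows "(u \<bullet> v)\<^sup>2 / (u \<bullet> (S *v u)) + (u \<bullet> (V *v u))\<^sup>2 / (2 * (u \<bullet> (S *v u))\<^sup>2)
           \<le> fisher_norm2 (\<mu>, S) (v, V)"
proof -
  define P where "P = matrix_inv S"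
  define s where "s = u \<bullet> (S *v u)"
  define q where "q = u \<bullet> (V *v u)"
  have s: "s > 0" using S u by (simp add: s_def pos_def_mat_def)
  have P: "psd_mat P" unfolding P_def by (rule psd_mat_matrix_inv[OF S])
  have PS: "P ** S = mat 1" unfolding P_def by (intro matrix_inv_left pos_def_mat_invertible S)
  have PSx: "P *v (S *v x) = x" for x by (simp add: matrix_vector_mul_assoc PS)
  have Psym: "x \<bullet> (P *v y) = (P *v x) \<bullet> y" for x y
    using P by (simp add: psd_mat_def symmetric_inner)
  have "(u \<bullet> v)\<^sup>2 \<le> s * (v \<bullet> (P *v v))"
    using psd_mat_cauchy_schwarz[OF P, of "S *v u" v]
    by (simp add: Psym[of "S *v u"] PSx s_def inner_commute[of _ u])
  then have 1: "(u \<bullet> v)\<^sup>2 / s \<le> v \<bullet> (P *v v)" using s by (simp add: field_simps)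
  define W where "W = outer (S *v u)"
  \<comment> \<open>In the trace form, pairing with \<open>W\<close> evaluates the quadratic form of
    \<open>A\<close> at \<open>u\<close>.\<close>
  have tr: "trace ((P ** A) ** (P ** W)) = u \<bullet> (A *v u)" for A
  proof -
    have "trace ((P ** A) ** (P ** W)) = trace ((P ** A ** P) ** W)" by (simp add: matrix_mul_assoc)
    also have "\<dots> = (S *v u) \<bullet> (P *v (A *v (P *v (S *v u))))"
      by (simp add: W_def trace_mult_outer matrix_vector_mul_assoc matrix_mul_assoc)
    finally show ?thesis by (simp add: Psym PSx)
  qed
  have uW: "u \<bullet> (W *v u) = s\<^sup>2"
    by (simp add: W_def outer_mult_vec s_def power2_eq_square inner_commute)
  \<comment> \<open>The pairings of \<open>V\<close> with \<open>W\<close> and of \<open>W\<close>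
    with itself are \<open>q\<close> and \<open>s^2\<close>, so \<open>c *\<^sub>R W\<close> is the
    orthogonal projection of \<open>V\<close> onto \<open>W\<close>, and the remainder has
    nonnegative square.\<close>
  define c where "c = q / s\<^sup>2"
  have "0 \<le> trace ((P ** (V - c *\<^sub>R W)) ** (P ** (V - c *\<^sub>R W)))"
    using V transpose_outer[of "S *v u"]
    by (intro trace_square_nonneg P) (simp add: W_def transpose_def vec_eq_iff)
  also have "\<dots> = trace ((P ** V) ** (P ** V)) - 2 * c * q + c\<^sup>2 * s\<^sup>2"
    using trace_mul_sym[of "P ** W" "P ** V"]
    by (simp add: matrix_diff_ldistrib matrix_diff_rdistrib matrix_mult_scaleR_left
        matrix_mult_scaleR_right trace_sub trace_scaleR tr uW power2_eq_square q_def
        right_diff_distrib)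
  also have "\<dots> = trace ((P ** V) ** (P ** V)) - q\<^sup>2 / s\<^sup>2"
    using s by (simp add: c_def power2_eq_square field_simps)
  finally show ?thesis using 1 by (simp add: P_def s_def q_def power2_eq_square)
qed

section \<open>Continuity and integrability of the speed of a curve\<close>

lemma continuous_on_det:
  fixes A :: "'a::topological_space \<Rightarrow> real^'n^'n"
  assumes "\<And>i j. continuous_on T (\<lambda>t. A t $ i $ j)"
  shows "continuous_on T (\<lambda>t. det (A t))"
  unfolding det_def by (intro continuous_intros assms)

text \<open>Cramer's rule for column \<open>j\<close> of the inverse; it exhibits the entries as
  quotients of determinants, hence continuous in \<open>A\<close>.\<close>

lemma matrix_inv_nth:
  fixes A :: "real^'n^'n"
  assumes "invertible A"
  shows "matrix_inv A $ k $ j = det (\<chi> i l. if l = k then axis j 1 $ i else A $ i $ l) / det A"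
proof -
  have "A *v (matrix_inv A *v axis j 1) = axis j 1"
    using assms by (simp add: matrix_vector_mul_assoc matrix_inv_right)
  then have "matrix_inv A *v axis j 1
      = (\<chi> k. det (\<chi> i l. if l = k then axis j 1 $ i else A $ i $ l) / det A)"
    using assms by (subst (asm) cramer) (auto simp: invertible_det_nz)
  then show ?thesis
    by (metis (no_types, lifting) vec_lambda_beta matrix_vector_mult_basis column_def)
qed

lemma continuous_on_matrix_inv:
  fixes A :: "'a::topological_space \<Rightarrow> real^'n^'n"
  assumes A: "continuous_on T A" and inv: "\<And>t. t \<in> T \<Longrightarrow> invertible (A t)"
  shows "continuous_on T (\<lambda>t. matrix_inv (A t))"
proof -
  have nth: "continuous_on T (\<lambda>t. A t $ i $ j)" for i j by (intro continuous_intros A)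
  have "continuous_on T (\<lambda>t. matrix_inv (A t) $ k $ j)" for k j
  proof -
    have "continuous_on T (\<lambda>t. if l = k then axis j 1 $ i else A t $ i $ l)" for i l
      by (cases "l = k") (simp_all add: nth)
    note entries = this nth
    have "continuous_on T
        (\<lambda>t. det (\<chi> i l. if l = k then axis j 1 $ i else A t $ i $ l) / det (A t))"
      using inv by (intro continuous_on_divide continuous_on_det ballI)
        (auto simp: invertible_det_nz[symmetric] entries)
    then show ?thesis by (rule continuous_on_eq) (simp add: matrix_inv_nth inv)
  qed
  then have "continuous_on T (\<lambda>t. \<chi> k j. matrix_inv (A t) $ k $ j)"
    by (intro continuous_on_vec_lambda)
  then show ?thesis by simp
qed

lemma continuous_on_matrix_mult:
  fixes A B :: "'a::topological_space \<Rightarrow> real^'n^'n"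
  assumes "continuous_on T A" "continuous_on T B"
  shows "continuous_on T (\<lambda>t. A t ** B t)"
  unfolding matrix_matrix_mult_def by (intro continuous_intros continuous_on_vec_lambda assms)

text \<open>Makes the speed integrable, so that a pointwise bound on it integrates to a bound on the
  length.\<close>

lemma continuous_on_fisher_norm2:
  fixes \<gamma> D :: "'a::topological_space \<Rightarrow> (real^'d) \<times> (real^'d^'d)"
  assumes "continuous_on T \<gamma>" "continuous_on T D" "\<And>t. t \<in> T \<Longrightarrow> \<gamma> t \<in> normal_params"
  shows "continuous_on T (\<lambda>t. fisher_norm2 (\<gamma> t) (D t))"
proof -
  have "invertible (snd (\<gamma> t))" if "t \<in> T" for t
    using assms(3)[OF that] by (auto simp: normal_params_def pos_def_mat_invertible)
  then have P: "continuous_on T (\<lambda>t. matrix_inv (snd (\<gamma> t)))"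
    by (intro continuous_on_matrix_inv continuous_intros assms)
  have "continuous_on T (\<lambda>t. fst (D t) \<bullet> (matrix_inv (snd (\<gamma> t)) *v fst (D t)) +
      1 / 2 * trace ((matrix_inv (snd (\<gamma> t)) ** snd (D t)) ** (matrix_inv (snd (\<gamma> t)) ** snd (D t))))"
    unfolding trace_def matrix_vector_mult_def
    by (intro continuous_intros continuous_on_matrix_mult continuous_on_vec_lambda P assms)
  also have "(\<lambda>t. fst (D t) \<bullet> (matrix_inv (snd (\<gamma> t)) *v fst (D t)) +
      1 / 2 * trace ((matrix_inv (snd (\<gamma> t)) ** snd (D t)) ** (matrix_inv (snd (\<gamma> t)) ** snd (D t))))
    = (\<lambda>t. fisher_norm2 (\<gamma> t) (D t))"
    by (rule ext) (metis fisher_norm2.simps prod.collapse)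
  finally show ?thesis .
qed

text \<open>Extracts the continuous first derivative that the lower bound works with.
  \<open>D 0\<close> agrees with \<open>\<gamma>\<close> only on the unit interval, so derivatives
  are transferred within that interval.\<close>

lemma normal_curvesE:
  assumes "\<gamma> \<in> normal_curves p q"
  obtains V where "\<And>t. t \<in> {0..1} \<Longrightarrow> (\<gamma> has_vector_derivative V t) (at t within {0..1})"
    "continuous_on {0..1} V"
    "fisher_length \<gamma> = integral {0..1} (\<lambda>t. sqrt (fisher_norm2 (\<gamma> t) (V t)))"
proof -
  obtain D where D0: "\<And>t. t \<in> {0..1} \<Longrightarrow> D 0 t = \<gamma> t"
    and D: "\<And>k t. t \<in> {0..1} \<Longrightarrow> (D k has_vector_derivative D (Suc k) t) (at t within {0..1})"
    using assms unfolding normal_curves_def smooth_path_def by blast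
  have der: "(\<gamma> has_vector_derivative D 1 t) (at t within {0..1})" if "t \<in> {0..1}" for t
    using D[OF that, of 0] by (auto intro: has_vector_derivative_transform[OF that D0[symmetric]])
  have "continuous_on {0..1} (D 1)"
    using D[of _ 1] by (intro continuous_on_vector_derivative) simp
  moreover have "fisher_length \<gamma> = integral {0..1} (\<lambda>t. sqrt (fisher_norm2 (\<gamma> t) (D 1 t)))"
    unfolding fisher_length_def
  proof (intro integral_cong)
    fix t :: real assume t: "t \<in> {0..1}"
    then have "vector_derivative \<gamma> (at t within {0..1}) = D 1 t"
      using vector_derivative_within_cbox[of 0 1 t \<gamma>] der[OF t] by simp
    then show "sqrt (fisher_norm2 (\<gamma> t) (vector_derivative \<gamma> (at t within {0..1})))
      = sqrt (fisher_norm2 (\<gamma> t) (D 1 t))" by simp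
  qed
  ultimately show thesis using that der by blast
qed

section \<open>The lower bound on lengths\<close>

lemma arsinh_real_nonneg_iff: "0 \<le> arsinh x \<longleftrightarrow> 0 \<le> x" for x :: real
  by (metis sinh_arsinh_real sinh_real_nonneg_iff)

text \<open>Cauchy--Schwarz for \<open>(A, B)\<close> against \<open>(1, -z)\<close>; the defect of
  the squares is \<open>(z A + B)^2\<close>. This is what makes the signed distance to a vertical
  geodesic 1-Lipschitz.\<close>

lemma arsinh_calibration:
  fixes z A B :: real
  shows "(A - z * B) / sqrt (z\<^sup>2 + 1) \<le> sqrt (A\<^sup>2 + B\<^sup>2)"
proof -
  have "(A - z * B)\<^sup>2 \<le> (z\<^sup>2 + 1) * (A\<^sup>2 + B\<^sup>2)"
    using zero_le_power2[of "z * A + B"] by (simp add: power2_eq_square algebra_simps)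
  then have "A - z * B \<le> sqrt (z\<^sup>2 + 1) * sqrt (A\<^sup>2 + B\<^sup>2)"
    by (metis real_le_rsqrt real_sqrt_mult)
  moreover have "sqrt (z\<^sup>2 + 1) > 0" by (simp add: add_nonneg_pos)
  ultimately show ?thesis by (simp add: divide_le_eq mult.commute)
qed

text \<open>A calibration argument: along the curve, the derivative of \<open>sqrt 2 * F c\<close>
  is at most the speed, and the fundamental theorem of calculus integrates this. The direction
  \<open>u\<close> and the centre \<open>c\<close> remain free.\<close>

lemma fisher_length_ge:
  fixes u :: "real^'d"
  defines "F \<equiv> \<lambda>c p. arsinh ((u \<bullet> fst p - c) / sqrt (2 * (u \<bullet> (snd p *v u))))"
  assumes \<gamma>: "\<gamma> \<in> normal_curves p q" and u: "u \<noteq> 0"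
  shows "sqrt 2 * (F c q - F c p) \<le> fisher_length \<gamma>"
proof -
  obtain V where V: "\<And>t. t \<in> {0..1} \<Longrightarrow> (\<gamma> has_vector_derivative V t) (at t within {0..1})"
    and contV: "continuous_on {0..1} V"
    and len: "fisher_length \<gamma> = integral {0..1} (\<lambda>t. sqrt (fisher_norm2 (\<gamma> t) (V t)))"
    using normal_curvesE[OF \<gamma>] by blast
  have mem: "\<gamma> t \<in> normal_params" if "t \<in> {0..1}" for t
    using \<gamma> that by (auto simp: normal_curves_def path_image_def)
  have contg: "continuous_on {0..1} \<gamma>"
    using V by (intro continuous_on_vector_derivative)
  have pd: "pos_def_mat (snd (\<gamma> t))" if "t \<in> {0..1}" for t
    using mem[OF that] by (auto simp: normal_params_def)
  define m where "m = (\<lambda>p::(real^'d) \<times> (real^'d^'d). u \<bullet> fst p)"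
  define s where "s = (\<lambda>p::(real^'d) \<times> (real^'d^'d). u \<bullet> (snd p *v u))"
  have "linear m" "linear s"
    by (auto intro!: linearI simp: m_def s_def inner_right_distrib
        matrix_vector_mult_add_rdistrib scaleR_matrix_vector_assoc[symmetric])
  then have bl: "bounded_linear m" "bounded_linear s" by (simp_all add: linear_conv_bounded_linear)
  have der_m: "((\<lambda>t. m (\<gamma> t)) has_real_derivative m (V t)) (at t within {0..1})"
    and der_s: "((\<lambda>t. s (\<gamma> t)) has_real_derivative s (V t)) (at t within {0..1})"
    if "t \<in> {0..1}" for t
    using bl V[OF that]
    by (auto simp: has_real_derivative_iff_has_vector_derivative
        intro: bounded_linear.has_vector_derivative)
  have s_pos: "s (\<gamma> t) > 0" if "t \<in> {0..1}" for t
    using pd[OF that] u by (simp add: s_def pos_def_mat_def)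
  \<comment> \<open>The antisymmetric part of the covariance vanishes identically along the curve,
    hence so does its derivative.\<close>
  have V_sym: "transpose (snd (V t)) = snd (V t)" if t: "t \<in> {0..1}" for t
  proof -
    have lin: "linear (\<lambda>p::(real^'d) \<times> (real^'d^'d). transpose (snd p) - snd p)"
      by (auto intro!: linearI simp: transpose_def vec_eq_iff algebra_simps)
    have "((\<lambda>t. transpose (snd (\<gamma> t)) - snd (\<gamma> t)) has_vector_derivative
        transpose (snd (V t)) - snd (V t)) (at t within {0..1})"
      using bounded_linear.has_vector_derivative[OF _ V[OF t]] lin
      by (simp add: linear_conv_bounded_linear)
    then have "((\<lambda>_. 0) has_vector_derivative transpose (snd (V t)) - snd (V t)) (at t within {0..1})"
      by (rule has_vector_derivative_transform[OF t, rotated]) (use pd in \<open>simp add: pos_def_mat_def\<close>)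
    then have "transpose (snd (V t)) - snd (V t) = 0"
      using vector_derivative_unique_within_closed_interval[of 0 1 t] t has_vector_derivative_const
      by (metis box_real(2) zero_less_one)
    then show ?thesis by simp
  qed
  define z where "z = (\<lambda>t. (m (\<gamma> t) - c) / sqrt (2 * s (\<gamma> t)))"
  \<comment> \<open>The derivative of \<open>sqrt 2 * arsinh (z t)\<close>, arranged in the form
    \<open>arsinh_calibration\<close> expects.\<close>
  define g where "g = (\<lambda>t. sqrt 2 * ((m (V t) / sqrt (2 * s (\<gamma> t)) -
      z t * (s (V t) / (2 * s (\<gamma> t)))) / sqrt ((z t)\<^sup>2 + 1)))"
  have der: "((\<lambda>t. sqrt 2 * arsinh (z t)) has_vector_derivative g t) (at t within {0..1})"
    if t: "t \<in> {0..1}" for t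
  proof -
    have [simp]: "\<bar>s (\<gamma> t)\<bar> = s (\<gamma> t)" using s_pos[OF t] by simp
    have "(z has_real_derivative m (V t) / sqrt (2 * s (\<gamma> t)) -
      z t * (s (V t) / (2 * s (\<gamma> t)))) (at t within {0..1})"
      unfolding z_def using s_pos[OF t]
      by (auto intro!: derivative_eq_intros der_m[OF t] der_s[OF t] simp: field_simps)
    then have "((\<lambda>t. sqrt 2 * arsinh (z t)) has_real_derivative g t) (at t within {0..1})"
      by (auto intro!: derivative_eq_intros DERIV_chain2[OF arsinh_real_has_field_derivative]
          simp: g_def)
    then show ?thesis by (simp add: has_real_derivative_iff_has_vector_derivative)
  qed
  have int_g: "(g has_integral sqrt 2 * arsinh (z 1) - sqrt 2 * arsinh (z 0)) {0..1}"
    by (rule fundamental_theorem_of_calculus) (auto intro: der)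
  have ends: "sqrt 2 * arsinh (z 1) - sqrt 2 * arsinh (z 0) = sqrt 2 * (F c q - F c p)"
    using \<gamma> by (simp add: z_def F_def m_def s_def normal_curves_def pathstart_def pathfinish_def
        right_diff_distrib)
  have bound: "g t \<le> sqrt (fisher_norm2 (\<gamma> t) (V t))" if t: "t \<in> {0..1}" for t
  proof -
    \<comment> \<open>Components of the marginal velocity in an orthogonal frame, scaled so that
      \<open>2 * (A^2 + B^2)\<close> is its squared univariate Fisher norm.\<close>
    define A where "A = m (V t) / sqrt (2 * s (\<gamma> t))"
    define B where "B = s (V t) / (2 * s (\<gamma> t))"
    have "g t \<le> sqrt 2 * sqrt (A\<^sup>2 + B\<^sup>2)"
      unfolding g_def A_def[symmetric] B_def[symmetric]
      by (intro mult_left_mono arsinh_calibration) simp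
    also have "\<dots> = sqrt ((m (V t))\<^sup>2 / s (\<gamma> t) + (s (V t))\<^sup>2 / (2 * (s (\<gamma> t))\<^sup>2))"
      using s_pos[OF t] unfolding real_sqrt_mult[symmetric]
      by (simp add: A_def B_def power_divide power2_eq_square field_simps)
    also have "\<dots> \<le> sqrt (fisher_norm2 (\<gamma> t) (V t))"
      using fisher_norm2_marginal[OF pd[OF t] V_sym[OF t] u, of "fst (V t)" "fst (\<gamma> t)"]
      by (simp add: m_def s_def)
    finally show ?thesis .
  qed
  have "(\<lambda>t. sqrt (fisher_norm2 (\<gamma> t) (V t))) integrable_on {0..1}"
    by (intro integrable_continuous_real continuous_intros continuous_on_fisher_norm2 contg contV mem)
  from has_integral_le[OF int_g integrable_integral[OF this] bound] show ?thesis
    by (simp only: len ends)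
qed

section \<open>The curve attaining the bound\<close>

lemma pos_def_rank_one_update:
  assumes S: "pos_def_mat S" and a: "a \<bullet> (S *v a) = 1" and s: "s > 0"
  shows "pos_def_mat (S + (s - 1) *\<^sub>R outer (S *v a))"
proof -
  have sym: "transpose S = S" using S by (simp add: pos_def_mat_def)
  have "0 < x \<bullet> ((S + (s - 1) *\<^sub>R outer (S *v a)) *v x)" if "x \<noteq> 0" for x
  proof -
    define X where "X = x \<bullet> (S *v x)"
    define q where "q = ((S *v a) \<bullet> x)\<^sup>2"
    have X: "X > 0" using S that by (simp add: X_def pos_def_mat_def)
    \<comment> \<open>The normalisation of \<open>a\<close> gives \<open>q \<le> X\<close>, so the
      form below is a sum of two nonnegative terms that cannot both vanish.\<close>
    have q: "0 \<le> q" "q \<le> X"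
      using psd_mat_cauchy_schwarz[OF pos_def_imp_psd[OF S], of a x] a sym
      by (simp_all add: q_def X_def symmetric_inner)
    have "x \<bullet> ((S + (s - 1) *\<^sub>R outer (S *v a)) *v x) = (X - q) + s * q"
      by (simp add: matrix_vector_mult_add_rdistrib inner_add_right outer_mult_vec X_def q_def
          scaleR_matrix_vector_assoc[symmetric] power2_eq_square inner_commute algebra_simps)
    also have "\<dots> > 0" using X q s by (cases "q = 0") (simp_all add: add_nonneg_pos)
    finally show ?thesis .
  qed
  moreover have "transpose (S + (s - 1) *\<^sub>R outer (S *v a)) = S + (s - 1) *\<^sub>R outer (S *v a)"
    using sym transpose_outer[of "S *v a"] by (simp add: transpose_def vec_eq_iff)
  ultimately show ?thesis by (simp add: pos_def_mat_def)
qed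

text \<open>The lift of univariate normals is isometric. The updated matrix sends \<open>a\<close>
  to \<open>s *\<^sub>R w\<close>, so its inverse sends \<open>w\<close> to \<open>a / s\<close>,
  and this single value determines both terms of the norm.\<close>

lemma fisher_norm2_rank_one_update:
  assumes S: "pos_def_mat S" and a: "a \<bullet> (S *v a) = 1" and s: "s > 0"
  defines "w \<equiv> S *v a"
  shows "fisher_norm2 (\<mu>, S + (s - 1) *\<^sub>R outer w) (m' *\<^sub>R w, s' *\<^sub>R outer w)
    = m'\<^sup>2 / s + s'\<^sup>2 / (2 * s\<^sup>2)"
proof -
  define U where "U = S + (s - 1) *\<^sub>R outer w"
  have "U *v a = s *\<^sub>R w"
    using a by (simp add: U_def matrix_vector_mult_add_rdistrib outer_mult_vec inner_commute w_def
        scaleR_matrix_vector_assoc[symmetric] algebra_simps)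
  then have "matrix_inv U *v (s *\<^sub>R w) = a"
    using matrix_inv_left[of U] pos_def_mat_invertible[OF pos_def_rank_one_update[OF S a s]]
    by (metis U_def w_def matrix_vector_mul_assoc matrix_vector_mul_lid)
  then have "s *\<^sub>R (matrix_inv U *v w) = a" by (simp add: matrix_vector_mult_scaleR)
  then have "s * (w \<bullet> (matrix_inv U *v w)) = 1"
    using a by (metis inner_commute inner_scaleR_right w_def)
  then have wUw: "w \<bullet> (matrix_inv U *v w) = 1 / s" using s by (simp add: field_simps)
  have "trace ((matrix_inv U ** outer w) ** (matrix_inv U ** outer w))
      = trace ((matrix_inv U ** outer w ** matrix_inv U) ** outer w)" by (simp add: matrix_mul_assoc)
  also have "\<dots> = (1 / s)\<^sup>2"
    by (simp add: trace_mult_outer matrix_vector_mul_assoc[symmetric] outer_mult_vec wUw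
        matrix_vector_mult_scaleR power2_eq_square)
  finally show ?thesis
    unfolding U_def[symmetric]
    by (simp add: wUw matrix_mult_scaleR_left matrix_mult_scaleR_right trace_scaleR
        matrix_vector_mult_scaleR power2_eq_square)
qed

text \<open>Since \<open>tanh' = 1 - tanh^2\<close>, polynomials in \<open>tanh\<close> are closed
  under differentiation; \<open>[:1, 0, -1:]\<close> is that factor and \<open>2 * c\<close> comes
  from the inner function.\<close>

lemma has_derivative_poly_tanh:
  fixes c :: real
  shows "((\<lambda>t. poly p (tanh (c * (2 * t - 1)))) has_real_derivative
    poly (smult (2 * c) (pderiv p * [:1, 0, -1:])) (tanh (c * (2 * t - 1)))) (at t within A)"
  by (auto intro!: derivative_eq_intros DERIV_chain2[OF poly_DERIV]
      simp: power2_eq_square algebra_simps)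

lemma fisher_rao_same_covariance:
  fixes S :: "real^'d^'d" and a \<mu> :: "real^'d"
  assumes S: "pos_def_mat S" and a: "a \<bullet> (S *v a) = 1" and c: "c \<ge> 0"
  defines "q \<equiv> (\<mu> + (2 * sqrt 2 * sinh c) *\<^sub>R (S *v a), S)"
  shows "fisher_rao (\<mu>, S) q = 2 * sqrt 2 * c"
proof -
  define w where "w = S *v a"
  \<comment> \<open>The geodesic is polynomial in \<open>T\<close>, and \<open>d\<close> is the derivative acting on polynomials in \<open>T\<close>;
    this gives all higher derivatives at once.\<close>
  define T where "T = (\<lambda>t. tanh (c * (2 * t - 1)))"
  define d where "d = (\<lambda>p. smult (2 * c) (pderiv p * [:1, 0, -1:]))"
  \<comment> \<open>With \<open>m = pm\<close> and \<open>s = ps + 1\<close> as functions of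
    \<open>T\<close>, this is the half-plane geodesic
    \<open>(m - sqrt 2 * sinh c)^2 + 2 * s = 2 * (cosh c)^2\<close>. \<open>ps\<close> is the
    variance minus 1 because \<open>S\<close> already contributes variance 1 along
    \<open>a\<close>.\<close>
  define pm where "pm = [:sqrt 2 * sinh c, sqrt 2 * cosh c:]"
  define ps where "ps = [:(cosh c)\<^sup>2 - 1, 0, - (cosh c)\<^sup>2:]"
  define D where "D = (\<lambda>k t. poly ((d ^^ k) pm) (T t) *\<^sub>R (w, 0) +
    poly ((d ^^ k) ps) (T t) *\<^sub>R (0, outer w) + (if k = 0 then (\<mu>, S) else 0))"
  define \<gamma> where "\<gamma> = D 0"
  have cosh: "cosh c > 0" by (rule cosh_real_pos)
  have T1: "(T t)\<^sup>2 < 1" for t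
    using tanh_real_bounds[of "c * (2 * t - 1)"]
    by (simp add: T_def abs_square_less_1 abs_less_iff)
  have T0: "T 0 = - sinh c / cosh c" "T 1 = sinh c / cosh c" by (simp_all add: T_def tanh_def)
  have ends: "poly pm (T 0) = 0" "poly pm (T 1) = 2 * sqrt 2 * sinh c"
      "poly ps (T 0) = 0" "poly ps (T 1) = 0"
  proof -
    have "poly ps x = (cosh c)\<^sup>2 - 1 - (cosh c)\<^sup>2 * x\<^sup>2" for x
      by (simp add: ps_def power2_eq_square algebra_simps)
    then show "poly ps (T 0) = 0" "poly ps (T 1) = 0"
      using cosh sinh_square_eq[of c] by (simp_all add: T0 power_divide)
  qed (use cosh in \<open>simp_all add: pm_def T0\<close>)
  have dp: "((\<lambda>t. poly p (T t)) has_real_derivative poly (d p) (T t)) (at t within A)" for p t A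
    unfolding T_def d_def by (rule has_derivative_poly_tanh)
  have derD: "(D k has_vector_derivative D (Suc k) t) (at t within A)" for k t A
  proof -
    have scale: "((\<lambda>t. poly p (T t) *\<^sub>R x) has_vector_derivative poly (d p) (T t) *\<^sub>R x) (at t within A)"
      for p and x :: "(real^'d) \<times> (real^'d^'d)"
      using has_vector_derivative_scaleR[OF dp has_vector_derivative_const] by simp
    have Suc: "D (Suc k) t = poly (d ((d ^^ k) pm)) (T t) *\<^sub>R (w, 0) +
        poly (d ((d ^^ k) ps)) (T t) *\<^sub>R (0, outer w) + 0"
      by (simp add: D_def)
    show ?thesis
      unfolding Suc unfolding D_def
      by (intro has_vector_derivative_add has_vector_derivative_const scale)
  qed
  have smooth: "smooth_path \<gamma>"
    unfolding smooth_path_def \<gamma>_def using derD by blast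
  define s where "s = (\<lambda>t. (cosh c)\<^sup>2 * (1 - (T t)\<^sup>2))"
  have s: "s t > 0" for t using T1 cosh by (simp add: s_def)
  have ps_T: "poly ps (T t) = s t - 1" for t
    by (simp add: s_def ps_def power2_eq_square algebra_simps)
  have \<gamma>: "\<gamma> t = (\<mu> + poly pm (T t) *\<^sub>R w, S + (s t - 1) *\<^sub>R outer w)" for t
    by (simp add: \<gamma>_def D_def ps_T)
  have "\<gamma> 0 = (\<mu>, S)" "\<gamma> 1 = q"
    using ends ps_T by (simp_all add: \<gamma> q_def w_def)
  moreover have "\<gamma> t \<in> normal_params" for t
    using pos_def_rank_one_update[OF S a s] by (simp add: \<gamma> normal_params_def w_def)
  ultimately have "\<gamma> \<in> normal_curves (\<mu>, S) q"
    using smooth by (auto simp: normal_curves_def path_image_def pathstart_def pathfinish_def)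
  moreover have "fisher_length \<gamma> = 2 * sqrt 2 * c"
  proof -
    \<comment> \<open>The \<open>tanh\<close> parametrisation has constant speed, so the length is
      read off without integration.\<close>
    have "sqrt (fisher_norm2 (\<gamma> t) (vector_derivative \<gamma> (at t within {0..1}))) = 2 * sqrt 2 * c"
      if "t \<in> {0..1}" for t
    proof -
      have "vector_derivative \<gamma> (at t within {0..1}) = D 1 t"
        using derD[of 0 t "{0..1}"] that
        by (simp add: vector_derivative_within_cbox[of 0 1, simplified] \<gamma>_def)
      also have "\<dots> = (poly (d pm) (T t) *\<^sub>R w, poly (d ps) (T t) *\<^sub>R outer w)"
        by (simp add: D_def)
      finally have "fisher_norm2 (\<gamma> t) (vector_derivative \<gamma> (at t within {0..1}))
        = (poly (d pm) (T t))\<^sup>2 / s t + (poly (d ps) (T t))\<^sup>2 / (2 * (s t)\<^sup>2)"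
        unfolding \<gamma> w_def by (simp only: fisher_norm2_rank_one_update[OF S a s])
      also have "\<dots> = 8 * c\<^sup>2"
      proof -
        have pm': "poly (d pm) (T t) = 2 * c * sqrt 2 * cosh c * (1 - (T t)\<^sup>2)"
          by (simp add: d_def pm_def pderiv_pCons power2_eq_square algebra_simps)
        have ps': "poly (d ps) (T t) = - 4 * c * T t * s t"
          by (simp add: d_def ps_def s_def pderiv_pCons power2_eq_square algebra_simps)
        have "(poly (d pm) (T t))\<^sup>2 = 8 * c\<^sup>2 * (1 - (T t)\<^sup>2) * s t"
          unfolding pm' s_def power_mult_distrib
          by (simp add: power2_eq_square[of "1 - (T t)\<^sup>2"])
        then show ?thesis
          unfolding ps' using s[of t] by (simp add: power2_eq_square field_simps)
      qed
      also have "\<dots> = (2 * sqrt 2 * c)\<^sup>2" by (simp add: power_mult_distrib)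
      finally show ?thesis using c by (simp only: real_sqrt_abs) simp
    qed
    then have "fisher_length \<gamma> = integral {0..1} (\<lambda>_::real. 2 * sqrt 2 * c)"
      unfolding fisher_length_def by (rule integral_cong)
    then show ?thesis by simp
  qed
  moreover have "2 * sqrt 2 * c \<le> fisher_length \<gamma>" if "\<gamma> \<in> normal_curves (\<mu>, S) q" for \<gamma>
  proof -
    have "a \<noteq> 0" using a by auto
    \<comment> \<open>Centred at the midpoint of the two marginal means, the \<open>arsinh\<close>
      values at the ends are \<open>-c\<close> and \<open>c\<close>.\<close>
    from fisher_length_ge[OF that this, of "a \<bullet> \<mu> + sqrt 2 * sinh c"]
    show ?thesis using a
      by (simp add: q_def inner_add_right arsinh_sinh_real)
  qed
  ultimately show ?thesis
    unfolding fisher_rao_def by (intro cInf_eq_minimum) (auto simp: image_iff intro!: bexI[of _ \<gamma>])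
qed

section \<open>Closed forms in the Mahalanobis distance\<close>

lemma fisher_rao_mahalanobis:
  fixes S :: "real^'d^'d"
  assumes S: "pos_def_mat S"
  shows "fisher_rao (\<mu>, S) (\<nu>, S) = 2 * sqrt 2 * arsinh (mahalanobis S \<mu> \<nu> / (2 * sqrt 2))"
proof -
  define \<Delta> where "\<Delta> = mahalanobis S \<mu> \<nu>"
  \<comment> \<open>\<open>b\<close> solves \<open>S b = \<nu> - \<mu>\<close>, so \<Delta> is its
    length in the form of \<open>S\<close>, and the required unit vector is
    \<open>b / \<Delta>\<close> when \<open>b\<close> is nonzero.\<close>
  define b where "b = matrix_inv S *v (\<nu> - \<mu>)"
  have Sb: "S *v b = \<nu> - \<mu>"
    using matrix_inv_right[OF pos_def_mat_invertible[OF S]]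
    by (simp add: b_def matrix_vector_mul_assoc)
  have bb: "0 \<le> b \<bullet> (S *v b)" using pos_def_imp_psd[OF S] by (simp add: psd_mat_def)
  have \<Delta>: "\<Delta> = sqrt (b \<bullet> (S *v b))"
    unfolding \<Delta>_def mahalanobis_def Sb by (simp add: b_def inner_commute)
  have norm: "((1 / r) *\<^sub>R x) \<bullet> (S *v ((1 / r) *\<^sub>R x)) = 1"
    if "x \<noteq> 0" "r = sqrt (x \<bullet> (S *v x))" for x r
  proof -
    have "x \<bullet> (S *v x) > 0" using S that by (simp add: pos_def_mat_def)
    then have "r * r = x \<bullet> (S *v x)" "r \<noteq> 0" using that by simp_all
    with \<open>x \<bullet> (S *v x) > 0\<close> show ?thesis by (simp add: matrix_vector_mult_scaleR field_simps)
  qed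
  obtain a where a: "a \<bullet> (S *v a) = 1" "\<nu> - \<mu> = \<Delta> *\<^sub>R (S *v a)"
  proof (cases "b = 0")
    case True
    \<comment> \<open>Equal means: \<Delta> is zero, so any normalised direction will do, here one
      from an arbitrary basis vector.\<close>
    then have "\<nu> - \<mu> = \<Delta> *\<^sub>R x" for x using Sb \<Delta> by simp
    then show thesis using that norm[OF _ refl, of "axis undefined 1"] by (metis axis_eq_0_iff zero_neq_one)
  next
    case False
    then have "b \<bullet> (S *v b) > 0" using S by (simp add: pos_def_mat_def)
    then have "\<Delta> \<noteq> 0" using \<Delta> by simp
    then have "\<nu> - \<mu> = \<Delta> *\<^sub>R (S *v ((1 / \<Delta>) *\<^sub>R b))"
      by (simp add: matrix_vector_mult_scaleR Sb)
    then show thesis by (rule that[OF norm[OF False \<Delta>]])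
  qed
  have "\<Delta> \<ge> 0" using \<Delta> bb by simp
  then have "arsinh (\<Delta> / (2 * sqrt 2)) \<ge> 0" by (simp add: arsinh_real_nonneg_iff)
  moreover have "\<nu> = \<mu> + \<Delta> *\<^sub>R (S *v a)" using a(2) by (simp add: diff_eq_eq add.commute)
  ultimately show ?thesis
    using fisher_rao_same_covariance[OF S a(1), of "arsinh (\<Delta> / (2 * sqrt 2))" \<mu>]
    unfolding \<Delta>_def[symmetric] by simp
qed

theorem proposition1:
  fixes \<Sigma> :: "real^'d^'d" and \<mu>\<^sub>1 \<mu>\<^sub>2 :: "real^'d" and \<Delta> :: real
  assumes "pos_def_mat \<Sigma>"
    and "\<Delta> = mahalanobis \<Sigma> \<mu>\<^sub>1 \<mu>\<^sub>2"
  shows "fisher_rao (\<mu>\<^sub>1, \<Sigma>) (\<mu>\<^sub>2, \<Sigma>)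
           = sqrt 2 * ln ((sqrt (8 + \<Delta>\<^sup>2) + \<Delta>) / (sqrt (8 + \<Delta>\<^sup>2) - \<Delta>))
       \<and> sqrt 2 * ln ((sqrt (8 + \<Delta>\<^sup>2) + \<Delta>) / (sqrt (8 + \<Delta>\<^sup>2) - \<Delta>))
           = fisher_rao (0 :: real^1, mat 1 :: real^1^1) (vec \<Delta>, mat 1)
       \<and> fisher_rao (0 :: real^1, mat 1 :: real^1^1) (vec \<Delta>, mat 1)
           = sqrt 2 * arcosh (1 + 1 / 4 * \<Delta>\<^sup>2)"
proof -
  \<comment> \<open>With this \<open>a\<close> the distance is \<open>2 * sqrt 2 * a\<close>, and
    both closed forms reduce to identities for \<open>cosh\<close> and \<open>sinh\<close>.\<close>
  define a where "a = arsinh (\<Delta> / (2 * sqrt 2))"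
  have "psd_mat (matrix_inv \<Sigma>)" using assms(1) by (rule psd_mat_matrix_inv)
  then have \<Delta>: "\<Delta> \<ge> 0" using assms(2) by (simp add: mahalanobis_def psd_mat_def)
  have a: "a \<ge> 0" using \<Delta> by (simp add: a_def arsinh_real_nonneg_iff)
  have sinh: "\<Delta> = 2 * sqrt 2 * sinh a" by (simp add: a_def)
  have sq: "8 + \<Delta>\<^sup>2 = (2 * sqrt 2 * cosh a)\<^sup>2"
    using cosh_square_eq[of a] by (simp add: sinh power_mult_distrib)
  have "sqrt (8 + \<Delta>\<^sup>2) = 2 * sqrt 2 * cosh a" unfolding sq by simp
  then have "(sqrt (8 + \<Delta>\<^sup>2) + \<Delta>) / (sqrt (8 + \<Delta>\<^sup>2) - \<Delta>)
      = (2 * sqrt 2 * (cosh a + sinh a)) / (2 * sqrt 2 * (cosh a - sinh a))"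
    by (simp only: sinh distrib_left right_diff_distrib)
  also have "\<dots> = exp a / exp (- a)" by (simp add: cosh_plus_sinh cosh_minus_sinh)
  also have "\<dots> = exp (2 * a)" by (simp add: exp_diff[symmetric])
  finally have ln: "ln ((sqrt (8 + \<Delta>\<^sup>2) + \<Delta>) / (sqrt (8 + \<Delta>\<^sup>2) - \<Delta>)) = 2 * a" by simp
  have "1 + 1 / 4 * \<Delta>\<^sup>2 = cosh (2 * a)"
    using cosh_square_eq[of a] by (simp add: sinh cosh_double power_mult_distrib)
  then have arcosh: "arcosh (1 + 1 / 4 * \<Delta>\<^sup>2) = 2 * a" using a by (simp add: arcosh_cosh_real)
  have id: "pos_def_mat (mat 1 :: real^1^1)" by (simp add: pos_def_mat_def)
  \<comment> \<open>The univariate pair has the same Mahalanobis distance, as \<Delta> is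
    nonnegative, so the same formula gives its Fisher-Rao distance.\<close>
  have "mahalanobis (mat 1 :: real^1^1) 0 (vec \<Delta>) = \<Delta>"
    using \<Delta> matrix_inv_unique[of "mat 1 :: real^1^1" "mat 1"]
    by (simp add: mahalanobis_def inner_vec_def)
  with fisher_rao_mahalanobis[OF id, of 0 "vec \<Delta>"]
    fisher_rao_mahalanobis[OF assms(1), of \<mu>\<^sub>1 \<mu>\<^sub>2]
  show ?thesis by (simp add: ln arcosh[simplified] a_def[symmetric] assms(2)[symmetric])
qed

end
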